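(* Let $m,n,t>0$ be integers with $t\le n$. (i) For all integers $0\le b\le a\le n-t$, the number of $(m,t)$-Dyck paths of height $n$ with exactly $a$ valleys and exactly $b$ returns is $$\binom{n-t}{a}\binom{mn-b-1}{a-b}-m\binom{n-t+1}{a+1}\binom{mn-b-2}{a-b-1}.$$ (ii) For all integers $0\le b\le a\le n-t$, the number of $(m,t)$-Dyck paths of height $n$ with exactly $a$ $m$-valleys and exactly $b$ returns is $$\binom{n-b-2}{a-b}\binom{mn-t+1}{n-t-a}-m\binom{n-b-1}{a-b}\binom{mn-t}{n-t-a-1}.$$ (iii) For every $i\in\{1,\ldots,m-1\}$ and all integers $a,b\ge 0$ with $a+b\le n-t$, the number of $(m,t)$-Dyck paths of height $n$ with exactly $a$ $i$-valleys and exactly $b$ returns is $$\frac{t+b}{n}\binom{n}{a}\binom{mn-t-b-1}{n-t-a-b}.$$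
   Context: An $(m,t)$-Dyck path of height $n$ is a lattice path from $(0,0)$ to $(mn,n)$ using only north steps $N=(0,1)$ and east steps $E=(1,0)$, which starts with at least $t$ north steps and stays weakly above the line $x=my$ (i.e. every lattice point $(p,q)$ on it satisfies $p\le mq$). A valley of such a path is a lattice point on the path that is preceded by an east step and followed by a north step. For $i\in\{1,\ldots,m\}$, an $i$-valley is a valley whose $x$-coordinate is congruent to $i$ modulo $m$ (so an $m$-valley has $x$-coordinate divisible by $m$). A return is a valley of the form $(mi,i)$ for some $i\in\{1,\ldots,n-1\}$. Binomial convention: $\binom{z}{k}=z(z-1)\cdots(z-k+1)/k!$ for integers $k\ge 0$ and arbitrary integers $z$, and $\binom{z}{k}=0$ for $k<0$. *)

theory Defs
  imports Complex_Main
begin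

datatype lattice_step = North | East

text \<open>A lattice path from the origin is the list of its steps; \<open>point_at w k\<close> is the
  lattice point \<open>(x, y)\<close> reached after its first \<open>k\<close> steps.\<close>

definition point_at :: "lattice_step list \<Rightarrow> nat \<Rightarrow> nat \<times> nat" where
  "point_at w k = (count_list (take k w) East, count_list (take k w) North)"

definition dyck_path :: "nat \<Rightarrow> nat \<Rightarrow> nat \<Rightarrow> lattice_step list \<Rightarrow> bool" where
  "dyck_path m t n w \<longleftrightarrow>
     point_at w (length w) = (m * n, n) \<and>
     take t w = replicate t North \<and>
     (\<forall>k\<le>length w. fst (point_at w k) \<le> m * snd (point_at w k))"

definition valleys :: "lattice_step list \<Rightarrow> (nat \<times> nat) set" where
  "valleys w = {point_at w (Suc k) |k. Suc k < length w \<and> w ! k = East \<and> w ! Suc k = North}"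

definition i_valleys :: "nat \<Rightarrow> nat \<Rightarrow> lattice_step list \<Rightarrow> (nat \<times> nat) set" where
  "i_valleys m i w = {p \<in> valleys w. fst p mod m = i mod m}"

definition returns :: "nat \<Rightarrow> nat \<Rightarrow> lattice_step list \<Rightarrow> (nat \<times> nat) set" where
  "returns m n w = {p \<in> valleys w. \<exists>i\<in>{1..n - 1}. p = (m * i, i)}"

text \<open>The binomial coefficient with integer entries, zero for negative lower index; it is
  real-valued because \<open>gchoose\<close> is constrained to fields.\<close>

definition zbinom :: "int \<Rightarrow> int \<Rightarrow> real" where
  "zbinom z k = (if k < 0 then 0 else real_of_int z gchoose nat k)"

end

theory Submission
  imports Defs "HOL-Computational_Algebra.Polynomial_FPS"
begin

text \<open>
  Read a path from its end: it is a Dyck path iff every suffix with \<open>e\<close> east and \<open>r\<close> north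
  steps satisfies \<open>m r \<le> e\<close>, and a valley is a return iff its suffix attains equality. A column of
  north steps contributes \<open>g = 1 / (1 - X)\<close>, or \<open>f = 1 + x X g\<close> if its valley is marked by the
  statistic, so \<open>m\<close> consecutive columns contribute \<open>\<phi> = f\<^sup>p g\<^sup>q\<close> with \<open>p + q = m\<close>. As in Lagrange
  inversion, the suffixes with \<open>m q\<close> east steps, \<open>r\<close> north steps and no returns have weight
  \<open>[X\<^sup>r] \<phi>\<^sup>q J\<close> with \<open>J = 1 - X \<phi>' / \<phi>\<close>; the only property of \<open>J\<close> that enters is that
  \<open>[X\<^sup>q] \<phi>\<^sup>q J = 0\<close> for \<open>q > 0\<close>. A return is a column that is forced to be nonempty, so it
  contributes one more factor \<open>X \<sigma>\<close> with \<open>\<sigma> = x g / f\<close> or \<open>\<sigma> = 1\<close>. For the three statistics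
  \<open>J\<close> becomes \<open>1 - m x X g (g / f)\<close> for all valleys and \<open>g / f - m X g\<close> for \<open>m\<close>-valleys, whereas
  \<open>[X\<^sup>N] \<phi>\<^sup>n J = (1 - N / n) [X\<^sup>N] \<phi>\<^sup>n\<close> settles \<open>i\<close>-valleys; the binomials are the coefficients
  of \<open>f\<^sup>P g\<^sup>Q\<close>.
\<close>

subsection \<open>Suffixes of Dyck paths\<close>

fun above :: "nat \<Rightarrow> lattice_step list \<Rightarrow> bool" where
  "above m [] \<longleftrightarrow> True"
| "above m (s # v) \<longleftrightarrow> m * count_list (s # v) North \<le> count_list (s # v) East \<and> above m v"

text \<open>The predicate sees a valley through the numbers of east and north steps after it, so
  prepending a step does not affect the valleys already counted.\<close>

definition valley_count :: "(nat \<Rightarrow> nat \<Rightarrow> bool) \<Rightarrow> lattice_step list \<Rightarrow> nat" where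
  "valley_count P w = card {k. Suc k < length w \<and> w ! k = East \<and> w ! Suc k = North \<and>
     P (count_list (drop (Suc k) w) East) (count_list (drop (Suc k) w) North)}"

definition suffix_words :: "nat \<Rightarrow> nat \<Rightarrow> nat \<Rightarrow> lattice_step list set" where
  "suffix_words m L r = {v. count_list v East = L \<and> count_list v North = r \<and> above m v}"

lemma above_iff:
  "above m v \<longleftrightarrow> (\<forall>k\<le>length v. m * count_list (drop k v) North \<le> count_list (drop k v) East)"
proof (induction v)
  case (Cons s v)
  have "(\<forall>k\<le>length (s # v). Q k) \<longleftrightarrow> Q 0 \<and> (\<forall>k\<le>length v. Q (Suc k))" for Q
    using All_less_Suc2[of "Suc (length v)" Q] by (simp add: less_Suc_eq_le)
  then show ?case using Cons by simp
qed simp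

section \<open>Effect of prepending a step\<close>

lemma valley_count_Nil [simp]: "valley_count P [] = 0"
  by (simp add: valley_count_def)

lemma valley_count_Cons:
  "valley_count P (s # v) = valley_count P v +
     of_bool (s = East \<and> v \<noteq> [] \<and> hd v = North \<and> P (count_list v East) (count_list v North))"
proof -
  define K where "K w = {k. Suc k < length w \<and> w ! k = East \<and> w ! Suc k = North \<and>
     P (count_list (drop (Suc k) w) East) (count_list (drop (Suc k) w) North)}" for w
  define C where "C \<longleftrightarrow> s = East \<and> v \<noteq> [] \<and> hd v = North \<and> P (count_list v East) (count_list v North)"
  have "K (s # v) = (if C then {0} else {}) \<union> Suc ` K v"
  proof (rule set_eqI)
    fix k show "k \<in> K (s # v) \<longleftrightarrow> k \<in> (if C then {0} else {}) \<union> Suc ` K v"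
      by (cases k; cases v) (auto simp: K_def C_def)
  qed
  moreover have "finite (K v)"
    by (rule finite_subset[of _ "{..<length v}"]) (auto simp: K_def)
  ultimately have "card (K (s # v)) = card (K v) + of_bool C"
    by (auto simp: card_image card_insert_if)
  then show ?thesis
    by (simp add: K_def C_def valley_count_def)
qed

lemma valley_count_simps [simp]:
  "valley_count P (North # v) = valley_count P v"
  "valley_count P [East] = 0"
  "valley_count P (East # East # v) = valley_count P (East # v)"
  "valley_count P (East # North # v) =
     valley_count P v + of_bool (P (count_list v East) (Suc (count_list v North)))"
  by (simp_all add: valley_count_Cons)

lemma length_count_steps: "length v = count_list v East + count_list v North"
proof (induction v)
  case (Cons s v) then show ?case by (cases s) auto
qed simp

lemma finite_suffix_words [simp]: "finite (suffix_words m L r)"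
proof -
  have "UNIV = {North, East}" using lattice_step.exhaust by blast
  then have "finite (UNIV :: lattice_step set)" by (metis finite.emptyI finite.insertI)
  from finite_lists_length_eq[OF this, of "L + r"] show ?thesis
    by (rule rev_finite_subset) (auto simp: suffix_words_def length_count_steps)
qed

lemma suffix_words_outside: "L < m * r \<Longrightarrow> suffix_words m L r = {}"
proof -
  assume "L < m * r"
  have "m * count_list v North \<le> count_list v East" if "above m v" for v
    using that by (cases v) auto
  with \<open>L < m * r\<close> show ?thesis by (fastforce simp: suffix_words_def)
qed

lemma suffix_words_0_0: "suffix_words m 0 0 = {[]}"
proof -
  have "v = []" if "v \<in> suffix_words m 0 0" for v
    using that length_count_steps[of v] by (simp add: suffix_words_def)
  then show ?thesis by (auto simp: suffix_words_def)
qed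

text \<open>The assumption is the inequality for the whole word, so only the tail remains to be
  constrained.\<close>

lemma suffix_words_step:
  assumes "m * r \<le> Suc L"
  shows "suffix_words m (Suc L) r =
    (#) East ` suffix_words m L r \<union> (if r = 0 then {} else (#) North ` suffix_words m (Suc L) (r - 1))"
    (is "_ = ?R")
proof (rule set_eqI)
  fix v show "v \<in> suffix_words m (Suc L) r \<longleftrightarrow> v \<in> ?R"
  proof (cases v)
    case Nil then show ?thesis by (auto simp: suffix_words_def)
  next
    case (Cons s u)
    have "m + m * (r - 1) = m * r" if "0 < r"
      using that by (cases r) auto
    with Cons assms show ?thesis by (cases s) (auto simp: suffix_words_def)
  qed
qed

lemma sum_suffix_words_step:
  fixes F :: "lattice_step list \<Rightarrow> 'a :: comm_monoid_add"
  assumes "m * r \<le> Suc L"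
  shows "sum F (suffix_words m (Suc L) r) =
    (\<Sum>v\<in>suffix_words m L r. F (East # v)) +
    (if r = 0 then 0 else \<Sum>v\<in>suffix_words m (Suc L) (r - 1). F (North # v))"
proof -
  have "(#) East ` A \<inter> (#) North ` B = {}" for A B by auto
  then show ?thesis
    unfolding suffix_words_step[OF assms] by (simp add: sum.union_disjoint sum.reindex o_def)
qed

text \<open>Relative to the end point \<open>(m * n, n)\<close>, the condition p \<le> m q at a
  lattice point becomes m r \<le> e for the suffix that starts there.\<close>

lemma dyck_path_iff:
  assumes "t \<le> n"
  shows "dyck_path m t n w \<longleftrightarrow> (\<exists>v \<in> suffix_words m (m * n) (n - t). w = replicate t North @ v)"
    (is "?L \<longleftrightarrow> ?R")
proof -
  have cnt: "count_list (replicate t North @ v) East = count_list v East"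
    "count_list (replicate t North @ v) North = t + count_list v North" for v
    by (induction t) auto
  have spl: "count_list (take k u) s + count_list (drop k u) s = count_list u s" for k and u :: "lattice_step list" and s
    by (metis append_take_drop_id count_list_append)
  have main: "(\<forall>k\<le>length w. fst (point_at w k) \<le> m * snd (point_at w k)) \<longleftrightarrow> above m v"
    if w: "w = replicate t North @ v" and c: "count_list v East = m * n" "count_list v North = n - t" for v
  proof -
    have 1: "fst (point_at w (t + k)) \<le> m * snd (point_at w (t + k)) \<longleftrightarrow>
        m * count_list (drop k v) North \<le> count_list (drop k v) East" for k
    proof -
      have "take (t + k) w = replicate t North @ take k v" using w by simp
      then have p: "point_at w (t + k) = (count_list (take k v) East, t + count_list (take k v) North)"
        by (simp only: point_at_def cnt)
      have a: "count_list (take k v) East = m * n - count_list (drop k v) East"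
        "count_list (drop k v) East \<le> m * n" using spl[of k v East] c by auto
      have b: "t + count_list (take k v) North = n - count_list (drop k v) North"
        "count_list (drop k v) North \<le> n" using spl[of k v North] c assms by auto
      from b(2) have "m * count_list (drop k v) North \<le> m * n" by simp
      with a(2) show ?thesis unfolding p fst_conv snd_conv a(1) b(1) diff_mult_distrib2 by linarith
    qed
    \<comment> \<open>During the initial north steps the first coordinate is still 0.\<close>
    have 2: "fst (point_at w k) \<le> m * snd (point_at w k)" if "k \<le> t" for k
    proof -
      have "take k w = replicate k North @ []" using w that by (simp add: min_absorb1)
      then have "count_list (take k w) East = 0" by (simp add: count_list_0_iff)
      then show ?thesis by (simp add: point_at_def)
    qed
    have "(\<forall>k\<le>length w. Q k) \<longleftrightarrow> (\<forall>k\<le>length v. Q (t + k))" if "\<And>k. k \<le> t \<Longrightarrow> Q k" for Q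
    proof -
      have "Q k" if "k \<le> length w" "\<forall>k\<le>length v. Q (t + k)" for k
      proof (cases "k \<le> t")
        case False
        with that(1) w have "k - t \<le> length v" by simp
        with that(2) False show ?thesis by (metis le_add_diff_inverse nat_le_linear)
      qed (simp add: \<open>\<And>k. k \<le> t \<Longrightarrow> Q k\<close>)
      then show ?thesis using w by auto
    qed
    from this[OF 2] show ?thesis by (simp add: 1 above_iff)
  qed
  show ?thesis
  proof
    assume L: ?L
    define v where "v = drop t w"
    have w: "w = replicate t North @ v"
      using L append_take_drop_id[of t w] by (simp add: dyck_path_def v_def)
    have c: "count_list v East = m * n" "count_list v North = n - t"
      using L cnt[of v] by (auto simp: dyck_path_def point_at_def w)
    show ?R using main[OF w c] L w c by (auto simp: dyck_path_def suffix_words_def)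
  next
    assume ?R
    then obtain v where w: "w = replicate t North @ v" and v: "v \<in> suffix_words m (m * n) (n - t)" by blast
    then have c: "count_list v East = m * n" "count_list v North = n - t"
      by (auto simp: suffix_words_def)
    show ?L using main[OF w c] v c assms cnt[of v]
      by (auto simp: dyck_path_def suffix_words_def point_at_def w)
  qed
qed

lemma valley_count_replicate_North: "valley_count P (replicate t North @ v) = valley_count P v"
  by (induction t) auto

text \<open>The coordinates of a point add up to the number of steps taken, so distinct indices give
  distinct valleys. The bounds e < X and 0 < r come from the east step before a valley and the north
  step after it.\<close>

lemma card_valleys_filter:
  assumes "count_list w East = X" "count_list w North = Y"
    and Q: "\<And>e r. e < X \<Longrightarrow> 0 < r \<Longrightarrow> r \<le> Y \<Longrightarrow> Q (X - e, Y - r) \<longleftrightarrow> P e r"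
  shows "card {p \<in> valleys w. Q p} = valley_count P w"
proof -
  let ?K = "{k. Suc k < length w \<and> w ! k = East \<and> w ! Suc k = North \<and> Q (point_at w (Suc k))}"
  have spl: "count_list (take k w) s + count_list (drop k w) s = count_list w s" for k s
    by (metis append_take_drop_id count_list_append)
  have "{p \<in> valleys w. Q p} = (\<lambda>k. point_at w (Suc k)) ` ?K"
    by (auto simp: valleys_def)
  moreover have "inj_on (\<lambda>k. point_at w (Suc k)) ?K"
  proof (rule inj_onI)
    fix i j assume "i \<in> ?K" "j \<in> ?K" "point_at w (Suc i) = point_at w (Suc j)"
    then have "length (take (Suc i) w) = length (take (Suc j) w)"
      unfolding length_count_steps by (simp add: point_at_def)
    with \<open>i \<in> ?K\<close> \<open>j \<in> ?K\<close> show "i = j" by simp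
  qed
  moreover have "?K = {k. Suc k < length w \<and> w ! k = East \<and> w ! Suc k = North \<and>
     P (count_list (drop (Suc k) w) East) (count_list (drop (Suc k) w) North)}" (is "_ = Collect ?P")
  proof (rule set_eqI)
    fix k
    show "k \<in> ?K \<longleftrightarrow> k \<in> Collect ?P"
    proof (cases "Suc k < length w \<and> w ! k = East \<and> w ! Suc k = North")
      case True
      then have k: "Suc k < length w" "w ! k = East" "w ! Suc k = North" by auto
      have "take (Suc k) w = take k w @ [East]"
        using k by (simp add: take_Suc_conv_app_nth)
      then have "0 < count_list (take (Suc k) w) East" by simp
      moreover have "drop (Suc k) w = North # drop (Suc (Suc k)) w"
        using k by (metis Cons_nth_drop_Suc)
      then have "0 < count_list (drop (Suc k) w) North" by simp
      moreover have "point_at w (Suc k) = (X - count_list (drop (Suc k) w) East, Y - count_list (drop (Suc k) w) North)"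
        unfolding point_at_def prod.inject
        using spl[of "Suc k" East] spl[of "Suc k" North] assms(1,2) by linarith
      ultimately show ?thesis
        using True spl[of "Suc k" East] spl[of "Suc k" North] assms(1,2)
          Q[of "count_list (drop (Suc k) w) East" "count_list (drop (Suc k) w) North"] by auto
    qed auto
  qed
  ultimately show ?thesis by (simp add: card_image valley_count_def)
qed

subsection \<open>Weighted suffix sums and Lagrange inversion\<close>

unbundle fps_syntax

text \<open>As a polynomial in the marking variable x, this is the coefficient of X^N in f^P
  g^(Q+1); see \<open>f_g_power_nth\<close>.\<close>

definition binomial_poly :: "nat \<Rightarrow> nat \<Rightarrow> nat \<Rightarrow> real poly" where
  "binomial_poly P Q N = (\<Sum>A\<le>N. monom (real (P choose A) * real ((N + Q) choose (N - A))) A)"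

text \<open>\<open>M\<close> selects residues modulo \<open>m\<close> of the number of east steps
  after a valley; a valley with a selected residue gets the factor \<open>x\<close>.\<close>

locale marked_valleys =
  fixes m :: nat and M :: "nat \<Rightarrow> bool" and x :: real
  assumes m_pos: "0 < m"
begin

abbreviation return_count :: "lattice_step list \<Rightarrow> nat" where
  "return_count \<equiv> valley_count (\<lambda>e r. e = m * r)"

abbreviation marked_count :: "lattice_step list \<Rightarrow> nat" where
  "marked_count \<equiv> valley_count (\<lambda>e r. M (e mod m))"

definition weight :: "nat \<Rightarrow> lattice_step list \<Rightarrow> real" where
  "weight b w = of_bool (return_count w = b) * x ^ marked_count w"

text \<open>Both sums run over the suffixes with \<open>L\<close> east and \<open>r\<close> north steps; they differ in the step
  preceding the suffix, which decides whether an initial north step creates a valley.\<close>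

definition north_sum :: "nat \<Rightarrow> nat \<Rightarrow> nat \<Rightarrow> real" where
  "north_sum b L r = (\<Sum>v\<in>suffix_words m L r. weight b v)"

definition east_sum :: "nat \<Rightarrow> nat \<Rightarrow> nat \<Rightarrow> real" where
  "east_sum b L r = (\<Sum>v\<in>suffix_words m L r. weight b (East # v))"

definition valley_weight :: "nat \<Rightarrow> real" where
  "valley_weight L = (if M (L mod m) then x else 1)"

section \<open>Recursions in the first step of the suffix\<close>

lemma weight_North [simp]: "weight b (North # v) = weight b v"
  and weight_East_East [simp]: "weight b (East # East # v) = weight b (East # v)"
  by (simp_all add: weight_def)

lemma weight_valley:
  assumes "count_list v East = L" "count_list v North = r"
  shows "weight b (East # North # v) = valley_weight L *
    (if L = m * Suc r then if b = 0 then 0 else weight (b - 1) v else weight b v)"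
  using assms by (auto simp: weight_def valley_weight_def)

lemma north_sum_rec:
  assumes "m * r \<le> Suc L"
  shows "north_sum b (Suc L) r =
    east_sum b L r + (if r = 0 then 0 else north_sum b (Suc L) (r - 1))"
  by (simp add: north_sum_def east_sum_def sum_suffix_words_step[OF assms])

text \<open>A suffix that begins with a north step forms a valley with the preceding east step. If
  \<open>Suc L = m * r\<close>, this valley is a return and uses up one of the \<open>b\<close>
  returns.\<close>

lemma east_sum_rec:
  assumes "m * r \<le> Suc L"
  shows "east_sum b (Suc L) r = east_sum b L r +
    (if r = 0 then 0 else valley_weight (Suc L) *
      (if Suc L = m * r then if b = 0 then 0 else north_sum (b - 1) (Suc L) (r - 1)
       else north_sum b (Suc L) (r - 1)))"
proof -
  have "(\<Sum>v\<in>suffix_words m (Suc L) (r - 1). weight b (East # North # v)) =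
    (\<Sum>v\<in>suffix_words m (Suc L) (r - 1). valley_weight (Suc L) *
      (if Suc L = m * r then if b = 0 then 0 else weight (b - 1) v else weight b v))" if "0 < r"
  proof (rule sum.cong)
    fix v assume "v \<in> suffix_words m (Suc L) (r - 1)"
    then have "count_list v East = Suc L" "count_list v North = r - 1"
      by (auto simp: suffix_words_def)
    from weight_valley[OF this] \<open>0 < r\<close>
    show "weight b (East # North # v) = valley_weight (Suc L) *
      (if Suc L = m * r then if b = 0 then 0 else weight (b - 1) v else weight b v)" by simp
  qed simp
  then show ?thesis
    by (auto simp: east_sum_def north_sum_def sum_suffix_words_step[OF assms] sum_distrib_left
        intro!: sum.cong)
qed

lemma east_sum_outside: "L < m * r \<Longrightarrow> east_sum b L r = 0"
  by (simp add: east_sum_def suffix_words_outside)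

lemma east_sum_0_0: "east_sum b 0 0 = of_bool (b = 0)"
  by (auto simp: east_sum_def suffix_words_0_0 weight_def)

section \<open>Power series of columns and blocks\<close>

definition g :: "real fps" where "g = inverse (1 - fps_X)"

definition f :: "real fps" where "f = 1 + fps_const x * fps_X * g"

text \<open>The index counts the east steps after the column, modulo \<open>m\<close>; returns can
  occur only in a column of residue 0, the last one of a block.\<close>

definition column :: "nat \<Rightarrow> real fps" where
  "column j = (if M (j mod m) then f else g)"

definition columns :: "nat \<Rightarrow> real fps" where
  "columns j = (\<Prod>l=1..j. column l)"

abbreviation phi :: "real fps" where "phi \<equiv> columns m"

definition J :: "real fps" where "J = 1 - fps_X * fps_deriv phi * inverse phi"

definition sigma :: "real fps" where
  "sigma = (if M 0 then fps_const x * g * inverse f else 1)"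

lemma g_eq: "g = 1 + fps_X * g"
proof -
  have "(1 - fps_X) * g = 1"
    unfolding g_def by (rule inverse_mult_eq_1') simp
  then show ?thesis by (simp add: algebra_simps)
qed

lemma g_0 [simp]: "g $ 0 = 1" by (simp add: g_def)

lemma f_0 [simp]: "f $ 0 = 1" by (simp add: f_def)

lemma f_inverse [simp]: "f * inverse f = 1"
  by (rule inverse_mult_eq_1') simp

lemma column_eq: "column j = 1 + fps_const (valley_weight j) * fps_X * g"
  by (simp add: column_def valley_weight_def f_def g_eq [symmetric])

lemma columns_0 [simp]: "columns 0 = 1" by (simp add: columns_def)

lemma columns_Suc: "columns (Suc j) = column (Suc j) * columns j"
  by (simp add: columns_def mult.commute)

lemma columns_at_0 [simp]: "columns j $ 0 = 1"
  by (induction j) (auto simp: columns_Suc column_def)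

text \<open>By the choice of J, l phi^l J = l phi^l - X (phi^l)', and X d/dX multiplies the k-th
  coefficient by k.\<close>

lemma phi_power_J_nth: "real l * (phi ^ l * J) $ k = (real l - real k) * (phi ^ l) $ k"
proof (cases k)
  case 0
  then show ?thesis by (simp add: J_def fps_nth_power_0)
next
  case (Suc i)
  have "phi * inverse phi = 1" by (rule inverse_mult_eq_1') simp
  have "fps_const (real l) * (phi ^ l * J) = fps_const (real l) * phi ^ l - fps_X * fps_deriv (phi ^ l)"
  proof (cases l)
    case (Suc l')
    have "phi ^ l * J = phi ^ l - fps_X * (phi ^ l' * fps_deriv phi) * (phi * inverse phi)"
      unfolding J_def Suc by (simp add: algebra_simps)
    then have "phi ^ l * J = phi ^ l - fps_X * (phi ^ l' * fps_deriv phi)"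
      unfolding \<open>phi * inverse phi = 1\<close> by simp
    moreover have "fps_const (real l) * (phi ^ l' * fps_deriv phi) = fps_deriv (phi ^ l)"
      unfolding Suc fps_deriv_power diff_Suc_1 by (simp only: mult_ac)
    ultimately show ?thesis by (simp add: right_diff_distrib mult.left_commute)
  qed simp
  then have "(fps_const (real l) * (phi ^ l * J)) $ k =
      (fps_const (real l) * phi ^ l - fps_X * fps_deriv (phi ^ l)) $ k" by (rule arg_cong)
  then show ?thesis using Suc by (simp add: fps_X_mult_nth left_diff_distrib)
qed

lemma phi_power_J: "0 < l \<Longrightarrow> (phi ^ l * J) $ l = 0"
  using phi_power_J_nth[of l l] by simp

lemma J_0: "J $ 0 = 1" by (simp add: J_def)

lemma phi_eq: "phi = (if M 0 then f else g) * columns (m - 1)"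
  using columns_Suc[of "m - 1"] m_pos by (simp add: column_def)

lemma f_inverse_mult: "f * (inverse f * a) = a"
  by (simp add: mult.assoc [symmetric])

text \<open>A further factor X turns the right-hand side into a block whose last column is nonempty:
  X times valley weight times g is the part of \<open>column m\<close> without the constant
  term.\<close>

lemma sigma_phi: "sigma * phi = fps_const (valley_weight m) * g * columns (m - 1)"
  unfolding phi_eq by (auto simp: sigma_def valley_weight_def f_inverse_mult mult_ac)

text \<open>The closed form for \<open>east_sum b (m * q + j) r\<close> as a series in the number of
  north steps \<open>r\<close>: q full blocks, j further columns and a factor X sigma for each
  return. The two agree only for m r \<le> m q + j.\<close>

definition east_fps :: "nat \<Rightarrow> nat \<Rightarrow> nat \<Rightarrow> real fps" where
  "east_fps b q j = (fps_X * sigma) ^ b * (columns j * (phi ^ q * J))"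

lemma east_fps_full: "east_fps b q m = east_fps b (Suc q) 0"
  by (simp add: east_fps_def mult_ac)

text \<open>This is g = 1 + X g read coefficientwise; it turns the recursion of
  \<open>north_sum\<close> in \<open>r\<close> into multiplication by g.\<close>

lemma add_X_g_nth:
  "A $ r + (if r = 0 then 0 else (g * A) $ (r - 1)) = (g * A) $ r"
proof -
  have "g * A = (1 + fps_X * g) * A" using g_eq by (rule arg_cong)
  also have "\<dots> = A + fps_X * (g * A)" by (simp only: distrib_right mult_1 mult.assoc)
  finally have "(g * A) $ r = (A + fps_X * (g * A)) $ r" by (rule arg_cong)
  also have "\<dots> = A $ r + (if r = 0 then 0 else (g * A) $ (r - 1))"
    by (simp add: fps_X_mult_nth)
  finally show ?thesis by (rule sym)
qed

text \<open>The right shape for \<open>east_sum_rec\<close> away from returns: an empty column, or a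
  nonempty one with its valley weight.\<close>

lemma column_mult_nth:
  "A $ r + (if r = 0 then 0 else valley_weight j * (g * A) $ (r - 1)) = (column j * A) $ r"
proof -
  have "column j * A = A + fps_X * (fps_const (valley_weight j) * (g * A))"
    by (simp add: column_eq algebra_simps)
  then show ?thesis by (auto simp: fps_X_mult_nth)
qed

section \<open>Closed form of the suffix sums\<close>

lemma north_sum_if_east_sum:
  assumes "\<And>r. r \<le> q \<Longrightarrow> east_sum b (m * q + j) r = east_fps b q j $ r" and "r \<le> q"
  shows "north_sum b (Suc (m * q + j)) r = (g * east_fps b q j) $ r"
  using \<open>r \<le> q\<close>
proof (induction r)
  case 0
  show ?case using assms(1)[of 0] add_X_g_nth[of _ 0] by (simp add: north_sum_rec)
next
  case (Suc r)
  have "m * Suc r \<le> m * q" using Suc.prems by (rule mult_le_mono2)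
  then have "m * Suc r \<le> Suc (m * q + j)" by linarith
  from north_sum_rec[OF this, of b] Suc assms(1)[of "Suc r"] add_X_g_nth[of "east_fps b q j" "Suc r"]
  show ?case by simp
qed

text \<open>The case \<open>r = q + 1\<close>, possible only for the first column of a block, is a return.\<close>

lemma east_sum_Suc:
  assumes IH: "\<And>b r. m * r \<le> m * q + j \<Longrightarrow> east_sum b (m * q + j) r = east_fps b q j $ r"
    and j: "Suc j \<le> m" and r: "m * r \<le> m * q + Suc j"
  shows "east_sum b (m * q + Suc j) r = east_fps b q (Suc j) $ r"
proof -
  let ?L = "m * q + j"
  have IH': "east_sum b ?L r = east_fps b q j $ r" if "r \<le> q" for b r
    by (rule IH) (use that in \<open>simp add: trans_le_add1\<close>)
  have north: "north_sum b (Suc ?L) r = (g * east_fps b q j) $ r" if "r \<le> q" for b r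
    using IH' that by (rule north_sum_if_east_sum)
  have vw: "valley_weight (Suc ?L) = valley_weight (Suc j)"
    unfolding valley_weight_def by (metis add_Suc_right mod_mult_self4)
  from r have rec: "east_sum b (Suc ?L) r = east_sum b ?L r +
    (if r = 0 then 0 else valley_weight (Suc j) *
      (if Suc ?L = m * r then if b = 0 then 0 else north_sum (b - 1) (Suc ?L) (r - 1)
       else north_sum b (Suc ?L) (r - 1)))"
    using east_sum_rec[of r ?L b] vw by simp
  show ?thesis
  proof (cases "r \<le> q")
    case True
    then have "m * r \<le> m * q" by simp
    then have "Suc ?L \<noteq> m * r" by linarith
    moreover have "north_sum b (Suc ?L) (r - 1) = (g * east_fps b q j) $ (r - 1)"
      by (rule north) (use True in simp)
    ultimately have "east_sum b (Suc ?L) r = (column (Suc j) * east_fps b q j) $ r"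
      using rec IH'[OF True] column_mult_nth[of "east_fps b q j" r "Suc j"] by (cases "r = 0") simp_all
    then show ?thesis by (simp add: east_fps_def columns_Suc mult_ac)
  next
    case False
    \<comment> \<open>Now r > q, and the chain m (q + 1) \<le> m r \<le> m q + j + 1 \<le> m q + m
      collapses to equalities.\<close>
    then have "m * Suc q \<le> m * r" by (intro mult_le_mono2) simp
    with r j have m: "Suc j = m" and "m * r = m * Suc q" by auto
    then have r: "r = Suc q" using m_pos by (metis mult_cancel1 less_not_refl)
    \<comment> \<open>No admissible suffix is left after removing an east step, so the word must
      begin with a north step and thus with a return.\<close>
    have "?L < m * r" using m r by simp
    then have "east_sum b ?L r = 0" by (rule east_sum_outside)
    moreover have "Suc ?L = m * r" using m r by simp
    ultimately have rec': "east_sum b (Suc ?L) r =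
        (if b = 0 then 0 else valley_weight (Suc j) * (g * east_fps (b - 1) q j) $ q)"
      using rec r north[of q "b - 1"] by simp
    show ?thesis
    proof (cases b)
      case 0
      \<comment> \<open>Without returns the sum is 0, and the series agrees because its diagonal
        coefficient vanishes.\<close>
      have "east_fps 0 q (Suc j) $ r = (phi ^ Suc q * J) $ Suc q"
        unfolding m r by (simp add: east_fps_def mult_ac)
      also have "\<dots> = 0" by (rule phi_power_J) simp
      finally show ?thesis using rec' 0 by simp
    next
      case (Suc c)
      have diff_m: "m - 1 = j" using m by simp
      \<comment> \<open>One of the factors X sigma is spent on the completed block, which becomes
        one with a nonempty last column; c returns remain.\<close>
      have "east_fps b q (Suc j) = fps_X * ((fps_X * sigma) ^ c * (phi ^ q * J) * (sigma * phi))"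
        unfolding m Suc by (simp add: east_fps_def mult_ac)
      also have "\<dots> = fps_X * (fps_const (valley_weight (Suc j)) * (g * east_fps c q j))"
        unfolding sigma_phi m diff_m by (simp only: east_fps_def mult_ac)
      finally show ?thesis using rec' Suc r by simp
    qed
  qed
qed

text \<open>Induction on the columns of a block inside an induction on the blocks;
  \<open>east_fps_full\<close> identifies the end of a block with the start of the next.\<close>

lemma east_sum_eq:
  assumes "j \<le> m" "m * r \<le> m * q + j"
  shows "east_sum b (m * q + j) r = east_fps b q j $ r"
proof -
  have step: "east_sum b (m * q + j) r = east_fps b q j $ r"
    if "\<And>b r. m * r \<le> m * q \<Longrightarrow> east_sum b (m * q) r = east_fps b q 0 $ r"
      "j \<le> m" "m * r \<le> m * q + j" for q j b r
    using that(2,3)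
  proof (induction j arbitrary: b r)
    case 0
    then show ?case using that(1)[of r b] by simp
  next
    case (Suc j)
    show ?case
      by (rule east_sum_Suc) (use Suc in auto)
  qed
  have "east_sum b (m * q) r = east_fps b q 0 $ r" if "m * r \<le> m * q" for q b r
    using that
  proof (induction q arbitrary: b r)
    case 0
    \<comment> \<open>Here r = 0: only the empty suffix occurs, and J has constant term 1.\<close>
    with m_pos show ?case by (auto simp: east_sum_0_0 east_fps_def J_0 power_0_left)
  next
    case (Suc q)
    have "east_sum b (m * q + m) r = east_fps b q m $ r"
      by (rule step) (use Suc in auto)
    then show ?case by (simp add: east_fps_full add.commute)
  qed
  from step[OF this assms] show ?thesis .
qed

text \<open>North steps at the front of the word create no valley, so the last column of the n-th
  block contributes g whether or not residue 0 is marked.\<close>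

lemma north_sum_eq:
  assumes "r < n"
  shows "north_sum b (m * n) r =
    (g * columns (m - 1) * ((fps_X * sigma) ^ b * (phi ^ (n - 1) * J))) $ r"
proof -
  obtain q where n: "n = Suc q" using assms by (cases n) auto
  have "north_sum b (Suc (m * q + (m - 1))) r = (g * east_fps b q (m - 1)) $ r"
  proof (rule north_sum_if_east_sum)
    fix r assume "r \<le> q"
    then have "m * r \<le> m * q" by simp
    then show "east_sum b (m * q + (m - 1)) r = east_fps b q (m - 1) $ r"
      by (intro east_sum_eq) linarith+
  qed (use assms n in simp)
  moreover have "Suc (m * q + (m - 1)) = m * n" using m_pos n by simp
  ultimately show ?thesis using n by (simp only: east_fps_def mult_ac diff_Suc_1)
qed

text \<open>With residue 0 marked, \<open>g * columns (m - 1)\<close> is (g/f) phi and X sigma is x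
  X g/f; the first column and the b returns combine to (g/f)^(b+1).\<close>

lemma north_sum_marked_0:
  assumes "r < n" "M 0"
  shows "north_sum b (m * n) r =
    (if r < b then 0 else x ^ b * ((g * inverse f) ^ Suc b * phi ^ n * J) $ (r - b))"
proof -
  have "g * columns (m - 1) = g * inverse f * phi"
    unfolding phi_eq using \<open>M 0\<close> by (simp add: f_inverse_mult mult_ac)
  moreover have "(fps_X * sigma) ^ b = fps_X ^ b * (fps_const (x ^ b) * (g * inverse f) ^ b)"
    using \<open>M 0\<close> by (simp only: sigma_def if_True power_mult_distrib fps_const_power mult.assoc)
  moreover have "phi ^ n = phi * phi ^ (n - 1)" using \<open>r < n\<close> by (cases n) auto
  ultimately have eq: "g * columns (m - 1) * ((fps_X * sigma) ^ b * (phi ^ (n - 1) * J)) =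
    fps_X ^ b * (fps_const (x ^ b) * ((g * inverse f) ^ Suc b * phi ^ n * J))"
    by (simp only: power_Suc mult_ac)
  show ?thesis
    unfolding north_sum_eq[OF \<open>r < n\<close>] eq
    by (simp only: fps_X_power_mult_nth fps_mult_left_const_nth)
qed

text \<open>With residue 0 unmarked, \<open>column m\<close> is already g and sigma is 1, so each
  return merely shifts the coefficient by one.\<close>

lemma north_sum_unmarked_0:
  assumes "r < n" "\<not> M 0"
  shows "north_sum b (m * n) r = (if r < b then 0 else (phi ^ n * J) $ (r - b))"
proof -
  have "g * columns (m - 1) = phi"
    unfolding phi_eq using \<open>\<not> M 0\<close> by simp
  moreover have "phi ^ n = phi * phi ^ (n - 1)" using \<open>r < n\<close> by (cases n) auto
  ultimately have eq: "g * columns (m - 1) * ((fps_X * sigma) ^ b * (phi ^ (n - 1) * J)) =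
    fps_X ^ b * (phi ^ n * J)"
    using \<open>\<not> M 0\<close> by (simp add: sigma_def)
  show ?thesis
    unfolding north_sum_eq[OF \<open>r < n\<close>] eq
    by (simp only: fps_X_power_mult_nth fps_mult_left_const_nth)
qed

subsection \<open>Coefficient extraction\<close>

lemma deriv_g: "fps_deriv g = g ^ 2"
proof -
  have "(1 - fps_X) * g = 1" unfolding g_def by (rule inverse_mult_eq_1') simp
  moreover have "fps_deriv ((1 - fps_X) * g) = (1 - fps_X) * fps_deriv g - g"
    by simp
  ultimately have "(1 - fps_X) * fps_deriv g = g" by simp
  then have "g * g = ((1 - fps_X) * g) * fps_deriv g" by (metis mult.commute mult.left_commute)
  also have "\<dots> = fps_deriv g" unfolding \<open>(1 - fps_X) * g = 1\<close> by simp
  finally show ?thesis by (simp add: power2_eq_square)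
qed

lemma deriv_f: "fps_deriv f = fps_const x * g ^ 2"
proof -
  have "fps_deriv f = fps_const x * (g * (1 + fps_X * g))"
    by (simp add: f_def deriv_g power2_eq_square algebra_simps)
  also have "1 + fps_X * g = g" by (rule g_eq [symmetric])
  finally show ?thesis by (simp add: power2_eq_square)
qed

text \<open>Induction on both indices; \<open>add_X_g_nth\<close> supplies Pascal's rule.\<close>

lemma g_power_nth: "(g ^ Suc Q) $ N = real ((N + Q) choose N)"
proof (induction Q arbitrary: N)
  case 0
  have "g = Abs_fps (\<lambda>_. 1)"
    unfolding g_def fps_inverse_gp' [symmetric] by (rule fps_inverse_idempotent) simp
  then have "g $ N = 1" by (metis fps_nth_Abs_fps)
  then show ?case by simp
next
  case (Suc Q)
  show ?case
  proof (induction N)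
    case (Suc N)
    have "(g ^ Suc (Suc Q)) $ Suc N = (g ^ Suc Q) $ Suc N + (g ^ Suc (Suc Q)) $ N"
      using add_X_g_nth[of "g ^ Suc Q" "Suc N"] by simp
    then show ?case using Suc Suc.IH \<open>\<And>N. (g ^ Suc Q) $ N = real ((N + Q) choose N)\<close>
      by (simp del: power_Suc)
  qed (simp add: fps_nth_power_0)
qed

text \<open>Expand f = 1 + x X g binomially. The A-th term needs the coefficient of X^(N-A) in
  g^(A+Q+1), whose upper binomial entry (N - A) + (A + Q) is independent of A.\<close>

lemma f_g_power_nth: "(f ^ P * g ^ Suc Q) $ N = poly (binomial_poly P Q N) x"
proof -
  have "f ^ P = (\<Sum>A\<le>P. of_nat (P choose A) * (fps_const x * fps_X * g) ^ A)"
    unfolding f_def by (subst add.commute, subst binomial_ring) simp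
  moreover have *: "of_nat (P choose A) * (fps_const x * fps_X * g) ^ A * g ^ Suc Q =
      fps_const (real (P choose A) * x ^ A) * (fps_X ^ A * g ^ Suc (A + Q))" for A
  proof -
    have "(of_nat (P choose A) :: real fps) = fps_const (real (P choose A))"
      by (simp add: fps_of_nat)
    then show ?thesis
      by (simp only: fps_const_mult [symmetric] fps_const_power [symmetric] power_mult_distrib
          power_add power_Suc mult_ac)
  qed
  ultimately have "f ^ P * g ^ Suc Q =
    (\<Sum>A\<le>P. fps_const (real (P choose A) * x ^ A) * (fps_X ^ A * g ^ Suc (A + Q)))"
    by (simp only: sum_distrib_right *)
  then have "(f ^ P * g ^ Suc Q) $ N =
    (\<Sum>A\<le>P. real (P choose A) * x ^ A * (if N < A then 0 else (g ^ Suc (A + Q)) $ (N - A)))"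
    by (simp add: fps_sum_nth fps_X_power_mult_nth del: power_Suc)
  also have "\<dots> = (\<Sum>A\<le>P. if A \<le> N then real (P choose A) * x ^ A * real ((N + Q) choose (N - A)) else 0)"
    unfolding g_power_nth by (intro sum.cong) auto
  also have "\<dots> = (\<Sum>A\<le>N. real (P choose A) * x ^ A * real ((N + Q) choose (N - A)))"
  proof -
    \<comment> \<open>Both ranges reduce to A \<le> min P N, since the binomial factor
      \<open>P choose A\<close> vanishes for A > P.\<close>
    have "(\<Sum>A\<le>P. if A \<le> N then h A else 0) = (\<Sum>A\<le>N. h A)"
      if "\<And>A. A > P \<Longrightarrow> h A = 0" for h :: "nat \<Rightarrow> real"
    proof -
      have "(\<Sum>A\<le>P. if A \<le> N then h A else 0) = sum h {A \<in> {..P}. A \<le> N}"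
        by (rule sum.inter_filter [symmetric]) simp
      also have "\<dots> = (\<Sum>A\<le>N. h A)"
        by (rule sum.mono_neutral_left) (use that in \<open>auto simp: not_less [symmetric]\<close>)
      finally show ?thesis .
    qed
    then show ?thesis by simp
  qed
  finally show ?thesis by (simp add: binomial_poly_def poly_sum poly_monom mult_ac)
qed

section \<open>The three markings\<close>

lemma rho_power: "k \<le> L \<Longrightarrow> (g * inverse f) ^ k * f ^ L = f ^ (L - k) * g ^ k"
proof -
  assume "k \<le> L"
  then have "f ^ L = f ^ (L - k) * f ^ k" by (simp flip: power_add)
  then have "(g * inverse f) ^ k * f ^ L = f ^ (L - k) * g ^ k * (f * inverse f) ^ k"
    by (simp only: power_mult_distrib mult_ac)
  then show ?thesis by simp
qed

text \<open>Every column is f, so phi'/phi = m f'/f with f' = x g^2. Each of the two terms of the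
  resulting J gives one binomial polynomial after the powers of g/f are absorbed into f^(m
  n).\<close>

lemma north_sum_all_marked:
  assumes M: "\<And>k. M k" and "r < n" and N: "r = b + N"
  shows "north_sum b (m * n) r = poly (monom 1 b * (binomial_poly (m * n - b - 1) b N -
    (if N = 0 then 0 else smult (real m) (monom 1 1 * binomial_poly (m * n - b - 2) (b + 2) (N - 1))))) x"
proof -
  let ?\<rho> = "g * inverse f"
  have "n \<le> m * n" using m_pos by simp
  have phi: "phi = f ^ m" by (simp add: columns_def column_def M)
  obtain k where k: "m = Suc k" using m_pos by (cases m) auto
  have "fps_deriv phi * inverse phi =
      fps_const (real m) * (fps_deriv f * inverse f) * (f * inverse f) ^ (m - 1)"
    unfolding phi fps_deriv_power fps_inverse_power
    by (simp only: k diff_Suc_1 power_Suc power_mult_distrib mult_ac)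
  then have "fps_deriv phi * inverse phi = fps_const (real m) * (fps_deriv f * inverse f)"
    by simp
  then have "J = 1 - fps_X * (fps_const (real m) * (fps_deriv f * inverse f))"
    by (simp only: J_def mult.assoc)
  also have "\<dots> = 1 - fps_X * (fps_const (real m * x) * (g * ?\<rho>))"
    by (simp only: deriv_f power2_eq_square fps_const_mult [symmetric] mult_ac)
  finally have J: "J = 1 - fps_X * (fps_const (real m * x) * (g * ?\<rho>))" .
  have "?\<rho> ^ Suc b * phi ^ n * J = ?\<rho> ^ Suc b * f ^ (m * n) -
      fps_X * (fps_const (real m * x) * (g * (?\<rho> ^ Suc (Suc b) * f ^ (m * n))))"
    unfolding J phi by (simp add: algebra_simps power_mult)
  then have *: "(?\<rho> ^ Suc b * phi ^ n * J) $ N = (?\<rho> ^ Suc b * f ^ (m * n)) $ N -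
      (if N = 0 then 0 else real m * x * (g * (?\<rho> ^ Suc (Suc b) * f ^ (m * n))) $ (N - 1))"
    by (simp only: fps_sub_nth fps_X_mult_nth fps_mult_left_const_nth)
  have 1: "(?\<rho> ^ Suc b * f ^ (m * n)) $ N = poly (binomial_poly (m * n - b - 1) b N) x"
  proof -
    have "Suc b \<le> m * n" using assms(2,3) \<open>n \<le> m * n\<close> by linarith
    then have "?\<rho> ^ Suc b * f ^ (m * n) = f ^ (m * n - b - 1) * g ^ Suc b"
      by (subst rho_power) simp_all
    then show ?thesis by (simp only: f_g_power_nth)
  qed
  have 2: "(g * (?\<rho> ^ Suc (Suc b) * f ^ (m * n))) $ (N - 1) =
      poly (binomial_poly (m * n - b - 2) (b + 2) (N - 1)) x" if "N \<noteq> 0"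
  proof -
    \<comment> \<open>N > 0 gives b + 2 \<le> b + N + 1 \<le> n, so the exponent of f is a genuine
      difference.\<close>
    have "Suc (Suc b) \<le> m * n" using assms(2,3) \<open>n \<le> m * n\<close> that by linarith
    then have "g * (?\<rho> ^ Suc (Suc b) * f ^ (m * n)) = f ^ (m * n - b - 2) * g ^ Suc (b + 2)"
      by (subst rho_power) (simp_all add: mult_ac)
    then show ?thesis by (simp only: f_g_power_nth)
  qed
  show ?thesis
    unfolding north_sum_marked_0[of r n b, OF \<open>r < n\<close> M] using * 1 2 N
    by (simp add: poly_monom del: power_Suc)
qed

lemma phi_single:
  assumes "j \<in> {1..m}" "\<And>l. l \<in> {1..m} \<Longrightarrow> M (l mod m) \<longleftrightarrow> l = j"
  shows "phi = f * g ^ (m - 1)"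
proof -
  have "phi = column j * (\<Prod>l\<in>{1..m} - {j}. column l)"
    unfolding columns_def using assms(1) by (subst prod.remove[of _ j]) auto
  also have "column j = f" using assms by (simp add: column_def)
  also have "(\<Prod>l\<in>{1..m} - {j}. column l) = (\<Prod>l\<in>{1..m} - {j}. g)"
    by (rule prod.cong) (use assms in \<open>auto simp: column_def\<close>)
  finally show ?thesis using assms(1) by simp
qed

text \<open>One column per block is f and the others are g, so X phi'/phi = (m - 1) X g + x X g
  (g/f); this simplifies J to g/f - m X g.\<close>

lemma north_sum_0_marked:
  assumes M: "\<And>k. M k \<longleftrightarrow> k = 0" and "r < n" and N: "r = b + N"
  shows "north_sum b (m * n) r = poly (monom 1 b * (binomial_poly (n - b - 2) (b + 1 + (m - 1) * n) N -
    (if N = 0 then 0 else smult (real m) (binomial_poly (n - b - 1) (b + 1 + (m - 1) * n) (N - 1))))) x"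
proof -
  let ?\<rho> = "g * inverse f"
  have phi: "phi = f * g ^ (m - 1)"
  proof (rule phi_single[of m])
    fix l assume "l \<in> {1..m}"
    then show "M (l mod m) \<longleftrightarrow> l = m" by (cases "l = m") (auto simp: M)
  qed (use m_pos in simp)
  have finv: "inverse phi * phi = 1" by (rule inverse_mult_eq_1) simp
  have "fps_X * fps_deriv phi = phi * (fps_const (real m - 1) * (fps_X * g) + fps_const x * (fps_X * g) * ?\<rho>)"
  proof -
    have "fps_deriv (g ^ (m - 1)) = fps_const (real m - 1) * (g * g ^ (m - 1))"
    proof (cases "m - 1")
      case (Suc k)
      then have "real m - 1 = real (Suc k)" using m_pos by linarith
      then show ?thesis unfolding Suc fps_deriv_power' deriv_g
        by (simp add: fps_of_nat power2_eq_square mult_ac del: of_nat_Suc)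
    qed (use m_pos in \<open>auto simp: Suc_diff_Suc le_Suc_eq\<close>)
    then have "fps_X * fps_deriv phi = fps_const (real m - 1) * (fps_X * g) * (f * g ^ (m - 1)) +
        fps_const x * (fps_X * g) * (g * g ^ (m - 1))"
      unfolding phi by (simp add: deriv_f power2_eq_square algebra_simps)
    \<comment> \<open>The inserted f/f exposes phi as a factor of the second summand.\<close>
    also have "g * g ^ (m - 1) = f * inverse f * (g * g ^ (m - 1))" by simp
    finally show ?thesis unfolding phi by (simp only: distrib_left mult_ac)
  qed
  then have "J = 1 - (fps_const (real m - 1) * (fps_X * g) + fps_const x * (fps_X * g) * ?\<rho>)"
    unfolding J_def by (simp only: mult.assoc [symmetric] mult.commute[of _ "inverse phi"] finv mult_1)
  \<comment> \<open>The bracket equals g = (g/f) f = g/f + x X g (g/f), whose second term cancels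
    the x-term.\<close>
  also have "\<dots> = (1 + fps_X * g) - fps_const x * (fps_X * g) * ?\<rho> - fps_const (real m) * (fps_X * g)"
    by (simp add: algebra_simps flip: fps_const_sub)
  also have "1 + fps_X * g = ?\<rho> * f"
    unfolding g_eq [symmetric] by (simp add: f_inverse_mult mult_ac)
  also have "?\<rho> * f = ?\<rho> + fps_const x * (fps_X * g) * ?\<rho>"
    by (subst (2) f_def) (simp add: algebra_simps)
  finally have J: "J = ?\<rho> - fps_const (real m) * (fps_X * g)" by simp
  let ?Q = "(m - 1) * n"
  have phin: "phi ^ n = f ^ n * g ^ ?Q"
    unfolding phi by (simp add: power_mult_distrib power_mult)
  have "?\<rho> ^ Suc b * phi ^ n * J = ?\<rho> ^ Suc (Suc b) * phi ^ n -
      fps_X * (fps_const (real m) * (g * (?\<rho> ^ Suc b * phi ^ n)))"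
    unfolding J by (simp add: algebra_simps)
  then have *: "(?\<rho> ^ Suc b * phi ^ n * J) $ N = (?\<rho> ^ Suc (Suc b) * phi ^ n) $ N -
      (if N = 0 then 0 else real m * (g * (?\<rho> ^ Suc b * phi ^ n)) $ (N - 1))"
    by (simp only: fps_sub_nth fps_X_mult_nth fps_mult_left_const_nth)
  have 1: "(?\<rho> ^ Suc (Suc b) * phi ^ n) $ N = poly (binomial_poly (n - b - 2) (b + 1 + ?Q) N) x"
  proof (cases N)
    \<comment> \<open>Here b + 2 may exceed n, and \<open>n - b - 2\<close> is then truncated; this
      is harmless because both constant coefficients are 1.\<close>
    case 0
    then show ?thesis
      by (simp add: binomial_poly_def poly_monom fps_nth_power_0 del: power_Suc)
  next
    case (Suc N')
    then have "Suc (Suc b) \<le> n" using assms by simp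
    then have "?\<rho> ^ Suc (Suc b) * phi ^ n = f ^ (n - Suc (Suc b)) * g ^ Suc (b + 1 + ?Q)"
      unfolding phin mult.assoc [symmetric] by (subst rho_power) (simp_all add: power_add mult_ac)
    also have "n - Suc (Suc b) = n - b - 2" by simp
    finally show ?thesis by (simp only: f_g_power_nth)
  qed
  have 2: "(g * (?\<rho> ^ Suc b * phi ^ n)) $ (N - 1) = poly (binomial_poly (n - b - 1) (b + 1 + ?Q) (N - 1)) x"
  proof -
    have "Suc b \<le> n" using assms by simp
    then have "?\<rho> ^ Suc b * phi ^ n = f ^ (n - Suc b) * g ^ Suc b * g ^ ?Q"
      unfolding phin mult.assoc [symmetric] by (subst rho_power) simp_all
    then have "g * (?\<rho> ^ Suc b * phi ^ n) = f ^ (n - Suc b) * g ^ Suc (b + 1 + ?Q)"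
      by (simp add: power_add mult_ac)
    also have "n - Suc b = n - b - 1" by simp
    finally show ?thesis by (simp only: f_g_power_nth)
  qed
  show ?thesis
    unfolding north_sum_marked_0[of r n b, OF \<open>r < n\<close> iffD2[OF M refl]] using * 1 2 N
    by (simp add: poly_monom del: power_Suc)
qed

text \<open>Residue 0 is unmarked, so b enters only through N = r - b, and
  \<open>phi_power_J_nth\<close> with l = n yields the factor (n - N)/n.\<close>

lemma north_sum_single_marked:
  assumes M: "\<And>k. M k \<longleftrightarrow> k = j" and j: "0 < j" "j < m" and "r < n" and N: "r = b + N"
  shows "north_sum b (m * n) r =
    poly (smult ((real n - real N) / real n) (binomial_poly n ((m - 1) * n - 1) N)) x"
proof -
  have phi: "phi = f * g ^ (m - 1)"
  proof (rule phi_single[of j])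
    fix l assume "l \<in> {1..m}"
    then show "M (l mod m) \<longleftrightarrow> l = j" using j by (cases "l = m") (auto simp: M)
  qed (use j in simp)
  \<comment> \<open>0 < j < m forces m > 1, so the exponent of g is a successor, as
    \<open>f_g_power_nth\<close> demands.\<close>
  have "0 < (m - 1) * n" using j \<open>r < n\<close> by simp
  then have "phi ^ n = f ^ n * g ^ Suc ((m - 1) * n - 1)"
    unfolding phi by (simp add: power_mult_distrib power_mult del: power_Suc)
  then have "(phi ^ n) $ N = poly (binomial_poly n ((m - 1) * n - 1) N) x"
    by (simp only: f_g_power_nth)
  moreover have "(phi ^ n * J) $ N = (real n - real N) / real n * (phi ^ n) $ N"
    using phi_power_J_nth[of n N] \<open>r < n\<close> by (simp add: field_simps)
  moreover have "north_sum b (m * n) r = (phi ^ n * J) $ N"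
    using north_sum_unmarked_0[of r n b] \<open>r < n\<close> M j N by simp
  ultimately show ?thesis by simp
qed

end

subsection \<open>Counting paths\<close>

text \<open>An identity at every real x is an identity of polynomials, and a sum of monomials counts
  the elements with a given exponent.\<close>

lemma card_eq_coeff:
  fixes p :: "real poly"
  assumes "finite S" and "\<And>x. (\<Sum>v\<in>S. x ^ s v) = poly p x"
  shows "real (card {v \<in> S. s v = a}) = coeff p a"
proof -
  have "p = (\<Sum>v\<in>S. monom 1 (s v))"
    unfolding poly_eq_poly_eq_iff [symmetric]
    by (rule ext) (simp add: poly_sum poly_monom assms(2))
  then have "coeff p a = (\<Sum>v\<in>S. if s v = a then 1 else 0)"
    by (simp add: coeff_sum)
  also have "\<dots> = real (card {v \<in> S. s v = a})"
    using assms(1) by (simp add: sum.If_cases Int_def)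
  finally show ?thesis by simp
qed

text \<open>The range of heights is automatic: e < m n and 0 < r, with e = m r, give 1 \<le> n - r
  \<le> n - 1.\<close>

lemma card_returns:
  assumes "0 < m" "count_list w East = m * n" "count_list w North = n"
  shows "card (returns m n w) = valley_count (\<lambda>e r. e = m * r) w"
  unfolding returns_def
proof (rule card_valleys_filter[OF assms(2,3)])
  fix e r assume "e < m * n" "0 < r" "r \<le> n"
  then have "m * n - e = m * (n - r) \<longleftrightarrow> e = m * r"
    using mult_le_mono2[of r n m] by (auto simp: diff_mult_distrib2)
  moreover have "n - r \<in> {1..n - 1}" if "e = m * r"
    using that \<open>e < m * n\<close> \<open>0 < r\<close> \<open>0 < m\<close> by auto
  ultimately show "(\<exists>i\<in>{1..n - 1}. (m * n - e, n - r) = (m * i, i)) \<longleftrightarrow> e = m * r"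
    by auto
qed

text \<open>The residues of e and of m n - e are both below m and add up to a multiple of m, hence
  to 0 or m. For i = m the residue seen from the end is 0.\<close>

lemma card_i_valleys:
  assumes "1 \<le> i" "i \<le> m" "count_list w East = m * n" "count_list w North = n"
  shows "card (i_valleys m i w) = valley_count (\<lambda>e r. e mod m = m - i) w"
  unfolding i_valleys_def
proof (rule card_valleys_filter[OF assms(3,4)])
  fix e r assume "e < m * n"
  let ?c = "e mod m" and ?d = "(m * n - e) mod m"
  have "(?c + ?d) mod m = 0"
    using \<open>e < m * n\<close> by (simp add: mod_add_eq)
  have "?c < m" "?d < m" using assms by auto
  moreover obtain k where k: "?c + ?d = m * k"
    using \<open>(?c + ?d) mod m = 0\<close> by auto
  moreover have "k < 2"
  proof (rule ccontr)
    assume "\<not> k < 2"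
    then have "m * 2 \<le> m * k" by (intro mult_le_mono2) simp
    with k \<open>?c < m\<close> \<open>?d < m\<close> show False by linarith
  qed
  ultimately have "?c + ?d = 0 \<or> ?c + ?d = m"
    by (auto simp: less_2_cases_iff)
  moreover have "i mod m = (if i = m then 0 else i)" using assms(2) by simp
  moreover have "?d = (if i = m then 0 else i) \<longleftrightarrow> ?c = m - i"
    if "?c + ?d = 0 \<or> ?c + ?d = m"
    using that \<open>?c < m\<close> \<open>?d < m\<close> assms(1,2) by (split if_split) linarith
  ultimately show "fst (m * n - e, n - r) mod m = i mod m \<longleftrightarrow> e mod m = m - i"
    by simp
qed

text \<open>Deleting the t initial north steps is a bijection onto the suffix words and preserves
  both valley counts; \<open>card_eq_coeff\<close> then extracts the paths with value a.\<close>

lemma card_dyck_paths_eq_coeff: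
  assumes "0 < m" "t \<le> n"
    and st: "\<And>w. count_list w East = m * n \<Longrightarrow> count_list w North = n \<Longrightarrow>
      st w = valley_count (\<lambda>e r. M (e mod m)) w"
    and p: "\<And>x. marked_valleys.north_sum m M x b (m * n) (n - t) = poly p x"
  shows "real (card {w. dyck_path m t n w \<and> st w = a \<and> card (returns m n w) = b}) = coeff p a"
proof -
  interpret marked_valleys m M x for x by standard fact
  let ?V = "suffix_words m (m * n) (n - t)" and ?N = "\<lambda>v. replicate t North @ v"
  let ?S = "{v \<in> ?V. return_count v = b}"
  have inj: "inj_on ?N A" for A by (simp add: inj_on_def)
  have stat: "st (?N v) = marked_count v" "card (returns m n (?N v)) = return_count v" if "v \<in> ?V" for v
  proof -
    have "count_list (replicate t North) East = 0" "count_list (replicate t North) North = t"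
      by (induction t) auto
    with that assms(2) have c: "count_list (?N v) East = m * n" "count_list (?N v) North = n"
      by (auto simp: suffix_words_def)
    show "st (?N v) = marked_count v"
      using st[OF c] by (simp add: valley_count_replicate_North)
    show "card (returns m n (?N v)) = return_count v"
      using card_returns[OF assms(1) c] by (simp add: valley_count_replicate_North)
  qed
  have "{w. dyck_path m t n w \<and> st w = a \<and> card (returns m n w) = b} =
      ?N ` {v \<in> ?S. marked_count v = a}"
    unfolding dyck_path_iff[OF assms(2)] using stat by auto
  then have "card {w. dyck_path m t n w \<and> st w = a \<and> card (returns m n w) = b} =
      card {v \<in> ?S. marked_count v = a}"
    by (simp only: card_image[OF inj])
  moreover have "real (card {v \<in> ?S. marked_count v = a}) = coeff p a"
  proof (rule card_eq_coeff[where S = ?S])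
    fix x :: real
    have "(\<Sum>v\<in>?S. x ^ marked_count v) = (\<Sum>v\<in>?V. if return_count v = b then x ^ marked_count v else 0)"
      by (rule sum.inter_filter[OF finite_suffix_words])
    also have "\<dots> = north_sum x b (m * n) (n - t)"
      unfolding north_sum_def weight_def by (rule sum.cong) auto
    finally show "(\<Sum>v\<in>?S. x ^ marked_count v) = poly p x" using p by simp
  qed simp
  ultimately show ?thesis by simp
qed

lemma coeff_binomial_poly:
  "coeff (binomial_poly P Q N) A =
    (if A \<le> N then real (P choose A) * real ((N + Q) choose (N - A)) else 0)"
proof -
  have "coeff (binomial_poly P Q N) A =
      (\<Sum>k\<le>N. if A = k then real (P choose k) * real ((N + Q) choose (N - k)) else 0)"
    by (auto simp: binomial_poly_def coeff_sum intro!: sum.cong)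
  then show ?thesis by simp
qed

section \<open>Binomial coefficients with integer entries\<close>

lemma zbinom_of_nat: "zbinom (int z) (int k) = real (z choose k)"
  by (simp add: zbinom_def binomial_gbinomial)

lemma zbinom_0 [simp]: "zbinom z 0 = 1"
  by (simp add: zbinom_def)

lemma zbinom_eq_binomial: "z = int p \<Longrightarrow> k = int q \<Longrightarrow> zbinom z k = real (p choose q)"
  by (simp add: zbinom_of_nat)

theorem theorem1p1:
  fixes m n t :: nat
  assumes "m > 0" and "n > 0" and "t > 0" and "t \<le> n"
  shows
    "(\<forall>a b :: nat. b \<le> a \<and> a \<le> n - t \<longrightarrow>
        real (card {w. dyck_path m t n w \<and> card (valleys w) = a \<and> card (returns m n w) = b})
        = zbinom (int n - int t) (int a)
            * zbinom (int m * int n - int b - 1) (int a - int b)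
          - real m * zbinom (int n - int t + 1) (int a + 1)
            * zbinom (int m * int n - int b - 2) (int a - int b - 1))
     \<and> (\<forall>a b :: nat. b \<le> a \<and> a \<le> n - t \<longrightarrow>
        real (card {w. dyck_path m t n w \<and> card (i_valleys m m w) = a \<and> card (returns m n w) = b})
        = zbinom (int n - int b - 2) (int a - int b)
            * zbinom (int m * int n - int t + 1) (int n - int t - int a)
          - real m * zbinom (int n - int b - 1) (int a - int b)
            * zbinom (int m * int n - int t) (int n - int t - int a - 1))
     \<and> (\<forall>i\<in>{1..m - 1}. \<forall>a b :: nat. a + b \<le> n - t \<longrightarrow>
        real (card {w. dyck_path m t n w \<and> card (i_valleys m i w) = a \<and> card (returns m n w) = b})
        = (real t + real b) / real n
            * zbinom (int n) (int a)
            * zbinom (int m * int n - int t - int b - 1) (int n - int t - int a - int b))"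
proof (intro conjI allI impI ballI)
  have mv: "marked_valleys m" by (rule marked_valleys.intro) fact
  \<comment> \<open>Since t > 0, fewer than n north steps remain, as the closed forms of
    \<open>north_sum\<close> require.\<close>
  have rn: "n - t < n" using assms by simp
  have mn: "m * n = n + (m - 1) * n" using assms(1) by (cases m) auto
  {
    fix a b :: nat
    assume ab: "b \<le> a \<and> a \<le> n - t"
    define N where "N = n - t - b"
    define A where "A = a - b"
    have N: "n - t = b + N" and a: "a = b + A" and AN: "A \<le> N"
      using ab by (auto simp: N_def A_def)
    have nt: "n = t + b + N" using N assms by linarith
    have imn: "int m * int n = int n + int ((m - 1) * n)"
      unfolding of_nat_mult [symmetric] of_nat_add [symmetric] mn [symmetric] ..
    have le: "t + b + N \<le> m * n" using nt mn by linarith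
    {
      let ?p = "monom 1 b * (binomial_poly (m * n - b - 1) b N -
        (if N = 0 then 0 else smult (real m)
          (monom 1 1 * binomial_poly (m * n - b - 2) (b + 2) (N - 1))))"
      have "real (card {w. dyck_path m t n w \<and> card (valleys w) = a \<and> card (returns m n w) = b}) = coeff ?p a"
        (is "?l = _")
      proof (rule card_dyck_paths_eq_coeff[where M = "\<lambda>_. True"])
        show "card (valleys w) = valley_count (\<lambda>e r. True) w"
          if "count_list w East = m * n" "count_list w North = n" for w
          using card_valleys_filter[OF that, of "\<lambda>_. True" "\<lambda>_ _. True"] by simp
        show "marked_valleys.north_sum m (\<lambda>_. True) x b (m * n) (n - t) = poly ?p x" for x
          by (rule marked_valleys.north_sum_all_marked[OF mv]) (use rn N in auto)
      qed (use assms in auto)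
      also have "\<dots> = real (m * n - b - 1 choose A) * real (n - t choose a) -
          (if A = 0 then 0 else real m * (real (m * n - b - 2 choose (A - 1)) * real (n - t + 1 choose (a + 1))))"
      proof -
        \<comment> \<open>Reflection of the lower index: N + b = n - t and N - A = (n - t) -
          a.\<close>
        have "(N + b) choose (N - A) = n - t choose a"
          using binomial_symmetric[of a "n - t"] N a AN by (simp add: add.commute)
        moreover have "(N - 1 + (b + 2)) choose (N - 1 - (A - 1)) = n - t + 1 choose (a + 1)"
          if "A \<noteq> 0"
          using binomial_symmetric[of "a + 1" "n - t + 1"] N a AN that
          by (simp add: add.commute)
        ultimately show ?thesis
          using a AN by (auto simp: coeff_monom_mult coeff_binomial_poly)
      qed
      also have "real (m * n - b - 1 choose A) = zbinom (int m * int n - int b - 1) (int a - int b)"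
        by (rule zbinom_eq_binomial [symmetric]) (use le a assms in \<open>simp_all add: of_nat_diff\<close>)
      also have "real (n - t choose a) = zbinom (int n - int t) (int a)"
        by (rule zbinom_eq_binomial [symmetric]) (use assms in simp_all)
      also have "real (n - t + 1 choose (a + 1)) = zbinom (int n - int t + 1) (int a + 1)"
        by (rule zbinom_eq_binomial [symmetric]) (use assms in simp_all)
      also have "(if A = 0 then 0 else real m * (real (m * n - b - 2 choose (A - 1)) * z)) =
          real m * z * zbinom (int m * int n - int b - 2) (int a - int b - 1)" for z
      proof (cases "A = 0")
        \<comment> \<open>The lower index a - b - 1 is -1, so the integer binomial is 0 by
          convention.\<close>
        case True
        then show ?thesis using a by (simp add: zbinom_def)
      next
        case False
        then have "2 + b \<le> m * n" using le AN assms by linarith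
        then have "zbinom (int m * int n - int b - 2) (int a - int b - 1) = real (m * n - b - 2 choose (A - 1))"
          by (intro zbinom_eq_binomial) (use False a in \<open>simp_all add: of_nat_diff\<close>)
        then show ?thesis using False by simp
      qed
      finally show "?l = zbinom (int n - int t) (int a)
            * zbinom (int m * int n - int b - 1) (int a - int b)
          - real m * zbinom (int n - int t + 1) (int a + 1)
            * zbinom (int m * int n - int b - 2) (int a - int b - 1)"
        by (simp only: mult_ac)
    next
      let ?Q = "b + 1 + (m - 1) * n"
      let ?p = "monom 1 b * (binomial_poly (n - b - 2) ?Q N -
        (if N = 0 then 0 else smult (real m) (binomial_poly (n - b - 1) ?Q (N - 1))))"
      have "real (card {w. dyck_path m t n w \<and> card (i_valleys m m w) = a \<and> card (returns m n w) = b}) = coeff ?p a"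
        (is "?l = _")
      proof (rule card_dyck_paths_eq_coeff[where M = "\<lambda>k. k = 0"])
        show "card (i_valleys m m w) = valley_count (\<lambda>e r. e mod m = 0) w"
          if "count_list w East = m * n" "count_list w North = n" for w
          using card_i_valleys[OF _ _ that, of m] assms by simp
        show "marked_valleys.north_sum m (\<lambda>k. k = 0) x b (m * n) (n - t) = poly ?p x" for x
          by (rule marked_valleys.north_sum_0_marked[OF mv]) (use rn N in auto)
      qed (use assms in auto)
      also have "\<dots> = real (n - b - 2 choose A) * real (N + ?Q choose (N - A)) -
          (if A = N then 0 else real m * (real (n - b - 1 choose A) * real (N - 1 + ?Q choose (N - 1 - A))))"
        using a AN by (auto simp: coeff_monom_mult coeff_binomial_poly)
      also have "real (n - b - 2 choose A) = zbinom (int n - int b - 2) (int a - int b)"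
      proof (cases "A = 0")
        \<comment> \<open>The upper entry n - b - 2 can be -1 here, but the lower index 0 makes the
          value 1 on both sides.\<close>
        case True
        then show ?thesis using a by simp
      next
        case False
        then have "2 + b \<le> n" using nt AN assms by linarith
        then show ?thesis
          by (intro zbinom_eq_binomial [symmetric]) (use a in \<open>simp_all add: of_nat_diff\<close>)
      qed
      \<comment> \<open>N + b = n - t and n + (m - 1) n = m n give the upper entry m n - t +
        1.\<close>
      also have "real (N + ?Q choose (N - A)) =
          zbinom (int m * int n - int t + 1) (int n - int t - int a)"
        by (rule zbinom_eq_binomial [symmetric]) (use imn nt a AN in \<open>simp_all add: of_nat_diff\<close>)
      also have "(if A = N then 0 else real m * (real (n - b - 1 choose A) * real (N - 1 + ?Q choose (N - 1 - A)))) =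
          real m * zbinom (int n - int b - 1) (int a - int b)
            * zbinom (int m * int n - int t) (int n - int t - int a - 1)"
      proof (cases "A = N")
        \<comment> \<open>The lower index n - t - a - 1 is -1, matching the missing second
          term.\<close>
        case True
        then show ?thesis using a nt by (simp add: zbinom_def)
      next
        case False
        have "zbinom (int n - int b - 1) (int a - int b) = real (n - b - 1 choose A)"
          by (rule zbinom_eq_binomial) (use nt a assms in \<open>simp_all add: of_nat_diff\<close>)
        moreover have "zbinom (int m * int n - int t) (int n - int t - int a - 1) =
            real (N - 1 + ?Q choose (N - 1 - A))"
          by (rule zbinom_eq_binomial) (use imn nt a AN False in \<open>simp_all add: of_nat_diff\<close>)
        ultimately show ?thesis using False by simp
      qed
      finally show "?l = zbinom (int n - int b - 2) (int a - int b)
            * zbinom (int m * int n - int t + 1) (int n - int t - int a)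
          - real m * zbinom (int n - int b - 1) (int a - int b)
            * zbinom (int m * int n - int t) (int n - int t - int a - 1)" .
    }
  next
    fix i a b :: nat
    assume i: "i \<in> {1..m - 1}" and ab: "a + b \<le> n - t"
    define N where "N = n - t - b"
    have N: "n - t = b + N" and aN: "a \<le> N"
      using ab by (auto simp: N_def)
    have nt: "n = t + b + N" using N assms by linarith
    have imn: "int m * int n = int n + int ((m - 1) * n)"
      unfolding of_nat_mult [symmetric] of_nat_add [symmetric] mn [symmetric] ..
    \<comment> \<open>The range of i is nonempty only for m > 1.\<close>
    have pos: "0 < (m - 1) * n" using i assms by (cases "m = 1") auto
    let ?Q = "(m - 1) * n - 1"
    obtain K where K: "(m - 1) * n = Suc K" using pos by (cases "(m - 1) * n") auto
    have "real (card {w. dyck_path m t n w \<and> card (i_valleys m i w) = a \<and> card (returns m n w) = b}) =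
        coeff (smult ((real n - real N) / real n) (binomial_poly n ?Q N)) a"
      (is "?l = coeff ?p a")
    proof (rule card_dyck_paths_eq_coeff[where M = "\<lambda>k. k = m - i"])
      show "card (i_valleys m i w) = valley_count (\<lambda>e r. e mod m = m - i) w"
        if "count_list w East = m * n" "count_list w North = n" for w
        using card_i_valleys[OF _ _ that, of i] i by auto
      show "marked_valleys.north_sum m (\<lambda>k. k = m - i) x b (m * n) (n - t) = poly ?p x" for x
        by (rule marked_valleys.north_sum_single_marked[OF mv]) (use rn N i in auto)
    qed (use assms in auto)
    also have "\<dots> = (real n - real N) / real n * (real (n choose a) * real (N + ?Q choose (N - a)))"
      using aN by (simp add: coeff_binomial_poly)
    also have "real n - real N = real t + real b" using nt by simp
    also have "real (n choose a) = zbinom (int n) (int a)" by (simp add: zbinom_of_nat)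
    also have "real (N + ?Q choose (N - a)) =
        zbinom (int m * int n - int t - int b - 1) (int n - int t - int a - int b)"
    proof (rule zbinom_eq_binomial [symmetric])
      show "int m * int n - int t - int b - 1 = int (N + ?Q)"
        using imn nt unfolding K by linarith
    qed (use nt aN in simp)
    finally show "?l = (real t + real b) / real n * zbinom (int n) (int a)
        * zbinom (int m * int n - int t - int b - 1) (int n - int t - int a - int b)"
      by (simp only: mult.assoc)
  }
qed

end
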